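(* Let $(X,\leq)$ be a partially ordered set endowed with a metric $d$ such that $(X,d)$ is complete, let $\varepsilon>0$ and $\lambda\in(0,1)$, and let $F:X\times X\to X$ be a mapping. Assume that: 1. $X$ is $\varepsilon$-chainable with respect to the partial order $\leq$; 2. $F$ is continuous; 3. $F$ has the mixed monotone property; 4. $F$ is $(\varepsilon,\lambda)$ uniformly locally contractive; 5. there exist $x_0,y_0\in X$ such that $x_0\leq F(x_0,y_0)$ and $y_0\geq F(y_0,x_0)$; 6. every pair of elements of $X$ has an upper bound or a lower bound in $X$. Let $(x,y)\in X\times X$ be a coupled fixed point of $F$, i.e. $F(x,y)=x$ and $F(y,x)=y$. Then $x=y$.
   Context: Let $(X,\leq)$ be a partially ordered set endowed with a metric $d$ and let $F:X\times X\to X$. $X\times X$ carries the metric $\eta((x,y),(u,v))=d(x,u)+d(y,v)$; continuity of $F$ is with respect to $\eta$ and $d$. $X$ is $\varepsilon$-chainable with respect to $\leq$ ($\varepsilon>0$) if for any $a,b\in X$ with $a\leq b$ there exist an integer $n\geq 1$ and points $a=\alpha_0\leq\alpha_1\leq\cdots\leq\alpha_{n-1}\leq\alpha_n=b$ of $X$ such that $d(\alpha_{i-1},\alpha_i)<\varepsilon$ for all $i=1,\dots,n$. $F$ has the mixed monotone property if for all $x,y\in X$: $x_1\leq x_2$ in $X$ implies $F(x_1,y)\leq F(x_2,y)$, and $y_1\leq y_2$ in $X$ implies $F(x,y_1)\geq F(x,y_2)$. $F$ is $(\varepsilon,\lambda)$ uniformly locally contractive ($\varepsilon>0$, $\lambda\in(0,1)$)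 if for all $x,y,u,v\in X$ with $x\geq u$, $y\leq v$ and $(x,y)\neq(u,v)$: $\frac{d(x,u)+d(y,v)}{2}<\varepsilon$ implies $d(F(x,y),F(u,v))<\frac{\lambda}{2}[d(x,u)+d(y,v)]$. *)

theory Defs
  imports "HOL-Analysis.Analysis"
begin

definition eta :: "'a::metric_space \<times> 'a \<Rightarrow> 'a \<times> 'a \<Rightarrow> real" where
  "eta p q = dist (fst p) (fst q) + dist (snd p) (snd q)"

lemma Metric_space_eta: "Metric_space UNIV (eta :: 'a::metric_space \<times> 'a \<Rightarrow> _)"
proof
  fix p q r :: "'a \<times> 'a"
  show "0 \<le> eta p q" by (simp add: eta_def)
  show "eta p q = eta q p" by (simp add: eta_def dist_commute)
  show "eta p q = 0 \<longleftrightarrow> p = q"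
    by (simp add: eta_def add_nonneg_eq_0_iff prod_eq_iff)
  show "eta p r \<le> eta p q + eta q r"
    using dist_triangle[of "fst p" "fst r" "fst q"] dist_triangle[of "snd p" "snd r" "snd q"]
    by (simp add: eta_def)
qed

definition chainable :: "real \<Rightarrow> 'a::{metric_space,order} itself \<Rightarrow> bool" where
  "chainable \<epsilon> (_ :: 'a itself) \<longleftrightarrow>
    (\<forall>a b :: 'a. a \<le> b \<longrightarrow>
      (\<exists>(n::nat) \<alpha>. n \<ge> 1 \<and> \<alpha> 0 = a \<and> \<alpha> n = b \<and>
        (\<forall>i\<in>{1..n}. \<alpha> (i - 1) \<le> \<alpha> i \<and> dist (\<alpha> (i - 1)) (\<alpha> i) < \<epsilon>)))"

(* Continuity refers to the metric eta, not to the Euclidean-style distance that the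
   library puts on the product type. *)
definition eta_continuous :: "('a::metric_space \<times> 'a \<Rightarrow> 'a) \<Rightarrow> bool" where
  "eta_continuous F \<longleftrightarrow>
    continuous_map (Metric_space.mtopology UNIV eta) (Metric_space.mtopology UNIV dist) F"

definition mixed_monotone :: "('a::order \<times> 'a \<Rightarrow> 'a) \<Rightarrow> bool" where
  "mixed_monotone F \<longleftrightarrow>
    (\<forall>x y. (\<forall>x1 x2. x1 \<le> x2 \<longrightarrow> F (x1, y) \<le> F (x2, y)) \<and>
           (\<forall>y1 y2. y1 \<le> y2 \<longrightarrow> F (x, y1) \<ge> F (x, y2)))"

definition uniformly_locally_contractive ::
    "real \<Rightarrow> real \<Rightarrow> ('a::{metric_space,order} \<times> 'a \<Rightarrow> 'a) \<Rightarrow> bool" where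
  "uniformly_locally_contractive \<epsilon> lam F \<longleftrightarrow>
    (\<forall>x y u v. x \<ge> u \<and> y \<le> v \<and> (x, y) \<noteq> (u, v) \<longrightarrow>
      (dist x u + dist y v) / 2 < \<epsilon> \<longrightarrow>
      dist (F (x, y)) (F (u, v)) < lam / 2 * (dist x u + dist y v))"

definition coupled_fixed_point :: "('a \<times> 'a \<Rightarrow> 'a) \<Rightarrow> 'a \<times> 'a \<Rightarrow> bool" where
  "coupled_fixed_point F p \<longleftrightarrow> F (fst p, snd p) = fst p \<and> F (snd p, fst p) = snd p"

end

theory Submission
  imports Defs
begin

text \<open>
  Let \<open>T (p, q) = (F (p, q), F (q, p))\<close>, so that coupled fixed points of \<open>F\<close> are
  fixed points of \<open>T\<close>, and order pairs by increasing first and decreasing second coordinate.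
  The mixed monotone property makes \<open>T\<close> monotone for this order, and two comparable pairs that are
  close together are brought together geometrically by the iterates of \<open>T\<close>
  (\<open>asymptotic_if_close\<close>). Call two pairs asymptotic when the \<open>eta\<close>-distance of their
  \<open>n\<close>-th iterates tends to zero. This is an equivalence relation, so chainability, applied to one
  coordinate at a time, extends it from close comparable pairs to all comparable pairs
  (\<open>asymptotic_if_comparable\<close>).

  Now let \<open>(x, y)\<close> be a coupled fixed point and \<open>z\<close> an upper or lower bound of \<open>x\<close> and \<open>y\<close>.
  The pair \<open>(z, y)\<close> is comparable both with \<open>(x, y)\<close> and with \<open>(z, z)\<close>, hence \<open>(x, y)\<close> is
  asymptotic to \<open>(z, z)\<close>. The iterates of \<open>(x, y)\<close> are constant and those of \<open>(z, z)\<close> stay on the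
  diagonal; since the distance of \<open>(x, y)\<close> from any point of the diagonal is at least
  \<open>dist x y\<close>, it follows that \<open>dist x y = 0\<close>.
\<close>

definition coupled_map :: "('a \<times> 'a \<Rightarrow> 'a) \<Rightarrow> 'a \<times> 'a \<Rightarrow> 'a \<times> 'a" where
  "coupled_map F p = (F (fst p, snd p), F (snd p, fst p))"

definition mixed_le :: "'a::order \<times> 'a \<Rightarrow> 'a \<times> 'a \<Rightarrow> bool" where
  "mixed_le p q \<longleftrightarrow> fst p \<le> fst q \<and> snd q \<le> snd p"

definition asymptotic :: "('a::metric_space \<times> 'a \<Rightarrow> 'a) \<Rightarrow> 'a \<times> 'a \<Rightarrow> 'a \<times> 'a \<Rightarrow> bool" where
  "asymptotic F p q \<longleftrightarrow> (\<lambda>n. eta ((coupled_map F ^^ n) p) ((coupled_map F ^^ n) q)) \<longlonglongrightarrow> 0"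

lemma eta_nonneg: "0 \<le> eta p q"
  by (simp add: eta_def)

lemma eta_commute: "eta p q = eta q p"
  by (simp add: eta_def dist_commute)

lemma eta_triangle: "eta p r \<le> eta p q + eta q r"
  using dist_triangle[of "fst p" "fst r" "fst q"] dist_triangle[of "snd p" "snd r" "snd q"]
  by (simp add: eta_def)

lemma asymptotic_refl: "asymptotic F p p"
  by (simp add: asymptotic_def eta_def)

lemma asymptotic_sym: "asymptotic F p q \<Longrightarrow> asymptotic F q p"
  by (simp add: asymptotic_def eta_commute)

lemma asymptotic_trans:
  assumes "asymptotic F p q" "asymptotic F q r"
  shows "asymptotic F p r"
  unfolding asymptotic_def
proof (rule Lim_null_comparison)
  let ?T = "\<lambda>n. coupled_map F ^^ n"
  show "(\<lambda>n. eta (?T n p) (?T n q) + eta (?T n q) (?T n r)) \<longlonglongrightarrow> 0"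
    using assms unfolding asymptotic_def by (rule tendsto_add_zero)
qed (simp add: eta_nonneg eta_triangle)

lemma coupled_map_mono:
  assumes "mixed_monotone F" "mixed_le p q"
  shows "mixed_le (coupled_map F p) (coupled_map F q)"
proof -
  have mono: "F (a, d) \<le> F (b, c)" if "a \<le> b" "c \<le> d" for a b c d
    using assms(1) that unfolding mixed_monotone_def by (blast intro: order_trans)
  show ?thesis
    using assms(2) by (simp add: mixed_le_def coupled_map_def mono del: prod.collapse)
qed

text \<open>
  Swapping the coordinates of two comparable pairs reverses their order, so the contraction
  hypothesis controls both coordinates of \<open>coupled_map F\<close>; the two factors \<open>lam / 2\<close> add up
  to \<open>lam\<close>. The strict inequality becomes a weak one to cover equal pairs.
\<close>

lemma coupled_map_contracts:
  assumes contr: "uniformly_locally_contractive \<epsilon> lam F"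
    and le: "mixed_le p q" and close: "eta p q < 2 * \<epsilon>"
  shows "eta (coupled_map F p) (coupled_map F q) \<le> lam * eta p q"
proof (cases "p = q")
  case True
  then show ?thesis by (simp add: eta_def)
next
  case False
  obtain u v x y where pq: "p = (u, v)" "q = (x, y)"
    by (metis surj_pair)
  have le': "u \<le> x" "y \<le> v" and close': "(dist x u + dist y v) / 2 < \<epsilon>"
    and ne: "(x, y) \<noteq> (u, v)" "(v, u) \<noteq> (y, x)"
    using le close False by (auto simp: pq mixed_le_def eta_def dist_commute)
  have "dist (F (x, y)) (F (u, v)) < lam / 2 * (dist x u + dist y v)"
    using contr le' close' ne unfolding uniformly_locally_contractive_def by blast
  moreover have "dist (F (v, u)) (F (y, x)) < lam / 2 * (dist v y + dist u x)"
    using contr le' close' ne unfolding uniformly_locally_contractive_def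
    by (metis add.commute dist_commute)
  ultimately show ?thesis
    by (simp add: pq eta_def coupled_map_def dist_commute algebra_simps)
qed

text \<open>
  Comparability and closeness are both preserved by \<open>coupled_map F\<close>, so the contraction can be
  applied at every step of the iteration.
\<close>

lemma asymptotic_if_close:
  assumes lam: "0 < lam" "lam < 1"
    and mono: "mixed_monotone F" and contr: "uniformly_locally_contractive \<epsilon> lam F"
    and le: "mixed_le p q" and close: "eta p q < 2 * \<epsilon>"
  shows "asymptotic F p q"
proof -
  let ?T = "\<lambda>n. coupled_map F ^^ n"
  have step: "mixed_le (?T n p) (?T n q) \<and> eta (?T n p) (?T n q) \<le> lam ^ n * eta p q" for n
  proof (induction n)
    case 0
    then show ?case using le by simp
  next
    case (Suc n)
    have "lam ^ n * eta p q \<le> 1 * eta p q"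
      using lam by (intro mult_right_mono eta_nonneg power_le_one) auto
    then have "eta (?T n p) (?T n q) < 2 * \<epsilon>"
      using Suc close by linarith
    then have "eta (?T (Suc n) p) (?T (Suc n) q) \<le> lam * eta (?T n p) (?T n q)"
      using coupled_map_contracts[OF contr] Suc by simp
    also have "\<dots> \<le> lam * (lam ^ n * eta p q)"
      using Suc lam by (intro mult_left_mono) auto
    finally show ?case
      using coupled_map_mono[OF mono] Suc by (simp add: mult.assoc)
  qed
  have "(\<lambda>n. lam ^ n * eta p q) \<longlonglongrightarrow> 0"
    using lam by (intro tendsto_mult_left_zero LIMSEQ_power_zero) auto
  then show ?thesis
    unfolding asymptotic_def
    by (rule Lim_null_comparison[rotated]) (simp add: step eta_nonneg)
qed

lemma chainable_induct [consumes 2, case_names refl trans close]: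
  fixes a b :: "'a::{metric_space,order}"
  assumes "chainable \<epsilon> TYPE('a)" "a \<le> b"
    and refl: "\<And>a. R a a"
    and trans: "\<And>a b c. R a b \<Longrightarrow> R b c \<Longrightarrow> R a c"
    and close: "\<And>a b. a \<le> b \<Longrightarrow> dist a b < \<epsilon> \<Longrightarrow> R a b"
  shows "R a b"
proof -
  obtain n :: nat and \<alpha> where ends: "\<alpha> 0 = a" "\<alpha> n = b"
    and links: "\<forall>i\<in>{1..n}. \<alpha> (i - 1) \<le> \<alpha> i \<and> dist (\<alpha> (i - 1)) (\<alpha> i) < \<epsilon>"
    using assms(1,2) unfolding chainable_def by blast
  have "k \<le> n \<Longrightarrow> R a (\<alpha> k)" for k
  proof (induction k)
    case 0
    then show ?case using refl ends by simp
  next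
    case (Suc k)
    then have "R (\<alpha> k) (\<alpha> (Suc k))"
      using links[rule_format, of "Suc k"] by (intro close) auto
    then show ?case using Suc trans by simp
  qed
  then show ?thesis using ends by blast
qed

text \<open>
  Chains exist in the underlying space and not among pairs, so for \<open>p = (u, v)\<close> and
  \<open>q = (x, y)\<close> one moves from \<open>(u, v)\<close> to \<open>(x, v)\<close> and on to \<open>(x, y)\<close>. Along a chain in one
  coordinate the \<open>eta\<close>-distance of neighbours is the distance of the moving coordinates, which
  is below \<open>\<epsilon>\<close>. In the second coordinate the chain ascends from \<open>y\<close> to \<open>v\<close>, against the
  order on pairs.
\<close>

lemma asymptotic_if_comparable:
  fixes F :: "'a::{metric_space,order} \<times> 'a \<Rightarrow> 'a"
  assumes lam: "0 < lam" "lam < 1"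
    and chain: "chainable \<epsilon> TYPE('a)"
    and mono: "mixed_monotone F" and contr: "uniformly_locally_contractive \<epsilon> lam F"
    and le: "mixed_le p q"
  shows "asymptotic F p q"
proof -
  note close_pairs = asymptotic_if_close[OF lam mono contr]
  have eps: "d < 2 * \<epsilon>" if "d < \<epsilon>" "0 \<le> d" for d
    using that by linarith
  have first: "asymptotic F (a, c) (b, c)" if "a \<le> b" for a b c
    using chain that
  proof (induction rule: chainable_induct)
    case (close a b)
    then show ?case
      by (intro close_pairs) (auto simp: mixed_le_def eta_def intro: eps)
  qed (blast intro: asymptotic_refl asymptotic_trans)+
  have second: "asymptotic F (c, b) (c, a)" if "a \<le> b" for a b c
    using chain that
  proof (induction rule: chainable_induct)
    case (close a b)
    then show ?case
      by (intro close_pairs)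
        (auto simp: mixed_le_def eta_def dist_commute intro: eps)
  qed (blast intro: asymptotic_refl asymptotic_trans)+
  have "asymptotic F p (fst q, snd p)" "asymptotic F (fst q, snd p) q"
    using first[of "fst p" "fst q" "snd p"] second[of "snd q" "snd p" "fst q"] le
    by (auto simp: mixed_le_def)
  then show ?thesis by (rule asymptotic_trans)
qed

lemma coupled_map_funpow_fixed:
  assumes "coupled_fixed_point F p"
  shows "(coupled_map F ^^ n) p = p"
  using assms by (induction n) (auto simp: coupled_fixed_point_def coupled_map_def)

lemma coupled_map_funpow_diagonal: "\<exists>w. (coupled_map F ^^ n) (z, z) = (w, w)"
  by (induction n) (auto simp: coupled_map_def)

theorem theorem2p4:
  fixes F :: "'a::{complete_space,order} \<times> 'a \<Rightarrow> 'a"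
    and \<epsilon> lam :: real
    and x y :: 'a
  assumes "\<epsilon> > 0"
    and "0 < lam" and "lam < 1"
    and "chainable \<epsilon> TYPE('a)"
    and "eta_continuous F"
    and "mixed_monotone F"
    and "uniformly_locally_contractive \<epsilon> lam F"
    and "\<exists>x0 y0. x0 \<le> F (x0, y0) \<and> y0 \<ge> F (y0, x0)"
    and "\<forall>a b :: 'a. (\<exists>z. a \<le> z \<and> b \<le> z) \<or> (\<exists>z. z \<le> a \<and> z \<le> b)"
    and "coupled_fixed_point F (x, y)"
  shows "x = y"
proof -
  have comparable: "asymptotic F p q" if "mixed_le p q \<or> mixed_le q p" for p q
    using that asymptotic_if_comparable[OF assms(2-4,6,7)] asymptotic_sym by blast
  obtain z where "x \<le> z \<and> y \<le> z \<or> z \<le> x \<and> z \<le> y"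
    using assms(9) by blast
  then have "asymptotic F (x, y) (z, y)" "asymptotic F (z, y) (z, z)"
    by (auto intro!: comparable simp: mixed_le_def)
  then have "asymptotic F (x, y) (z, z)"
    by (rule asymptotic_trans)
  then have lim: "(\<lambda>n. eta (x, y) ((coupled_map F ^^ n) (z, z))) \<longlonglongrightarrow> 0"
    by (simp add: asymptotic_def coupled_map_funpow_fixed[OF assms(10)])
  have "dist x y \<le> eta (x, y) ((coupled_map F ^^ n) (z, z))" for n
  proof -
    obtain w where "(coupled_map F ^^ n) (z, z) = (w, w)"
      using coupled_map_funpow_diagonal[of n F z] by (elim exE)
    then show ?thesis
      by (simp add: eta_def dist_triangle2)
  qed
  then have "dist x y \<le> 0"
    by (intro LIMSEQ_le_const[OF lim]) auto
  then show ?thesis by simp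
qed

end
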